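(* Let $l\simeq r$ and $\overline{L}[t]\lor C$ be clauses, $x$ a fresh variable, and $\mathcal{I}$ an inference system that admits equational derivability (ED). If there is a substitution $\theta$ such that $l\theta\triangleleft L[x]$ and $l\sigma\succ r\sigma$, where $\sigma=\theta\cdot\{x\mapsto t\}$, then the $\mathrm{Ind}_G$ inference $$\overline{L}[t]\lor C\;\vdash\;\mathrm{cnf}(\neg G[L[x]]\lor C)$$ is redundant in $\mathcal{I}\cup\{\mathrm{Ind}_G\}$ w.r.t. the clauses $l\simeq r$ and $(\overline{L}[t])[l\sigma\mapsto r\sigma]\lor C$.
   Context: Setting: (many-sorted) first-order logic with equality $\simeq$; equations are unordered. $E[s]$ denotes an expression $E$ with distinguished occurrence(s) of the term $s$; $E[s\mapsto t]$, or just $E[t]$, is the result of replacing them by $t$; in particular $L[x]$ is $L[t]$ with the distinguished $t$ replaced by $x$. $\overline{L}$ is the complement of the literal $L$. $s\triangleleft E$ means that $s$ is a strict subterm of $E$. $\theta\cdot\{x\mapsto t\}$ is the composition applying $\theta$ first. $\succ$ is a fixed reduction ordering (well-founded, stable under substitutions and contexts) that is total on ground terms; it is extended to literals and clauses by the bag (multiset) extension. $\mathrm{cnf}(F)$ is a satisfiability-preserving clausal normal form of $F$. An inference system $\mathcal{I}$ admits equational derivability (ED) if, for every substitution $\theta$, set of equations $\mathcal{C}$, equation $l\simeq r$ and clause $D[l\theta]$: $\mathcal{C}\vdash^*_{\mathcal{I}}D[l\theta]$ implies $\mathcal{C},l\simeq r\vdash^*_{\mathcal{I}}D[r\theta]$,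 where $\vdash^*_{\mathcal{I}}$ denotes derivability by finitely many inferences of $\mathcal{I}$. Induction rule: let $\mathcal{I}nd(\mathcal{T})$ be a fixed subset of the set $\mathcal{T}$ of all terms, and let $G$ be a second-order formula with exactly one free second-order variable $F$ such that $\forall F.(G[F]\to\forall x.F[x])$ is a valid induction schema. The rule $\mathrm{Ind}_G$ infers $\mathrm{cnf}(\neg G[L[x]]\lor C)$ from $\overline{L}[t]\lor C$, provided that $L[t]$ is ground and $t\in\mathcal{I}nd(\mathcal{T})$. Redundant $\mathrm{Ind}_G$ inference: an $\mathrm{Ind}_G$ inference $C\vdash\mathrm{cnf}(F)$ is redundant w.r.t. a set of equations $E$ and a clause $C'$ if $C\succ C'$ and there are a formula $F'$ and an $\mathrm{Ind}_G$ inference $C'\vdash\mathrm{cnf}(F')$ such that $F$ and $F'$ are equivalent modulo rewriting with $E$.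
   Formalization: Added: only ground terms lie below ground terms in ≻ (automatic with one sort). Otherwise many-sorted a ≻ f(y) is possible, the replaced literal need not be ground, and Ind_G does not apply. After replacement x may no longer occur in the literal. *)

theory Defs
  imports "HOL-Library.Multiset" "HOL-Library.Uprod"
begin

section \<open>Many-sorted terms, literals and clauses\<close>

datatype ('f, vars_trm: 'v) trm = Var 'v | Fun 'f "('f, 'v) trm list"

type_synonym ('f, 'v, 'w) subst = "'v \<Rightarrow> ('f, 'w) trm"

primrec subst_trm :: "('f, 'v) trm \<Rightarrow> ('f, 'v, 'w) subst \<Rightarrow> ('f, 'w) trm" (infixl "\<cdot>" 67) where
  "Var x \<cdot> \<theta> = \<theta> x"
| "Fun f ts \<cdot> \<theta> = Fun f (map (\<lambda>t. t \<cdot> \<theta>) ts)"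

definition comp_subst :: "('f, 'v, 'w) subst \<Rightarrow> ('f, 'w, 'u) subst \<Rightarrow> ('f, 'v, 'u) subst"
    (infixl "\<circ>\<^sub>s" 55) where
  "\<theta> \<circ>\<^sub>s \<tau> = (\<lambda>x. \<theta> x \<cdot> \<tau>)"

abbreviation sing :: "'v \<Rightarrow> ('f, 'v) trm \<Rightarrow> ('f, 'v, 'v) subst" where
  "sing x t \<equiv> Var(x := t)"

fun subterms :: "('f, 'v) trm \<Rightarrow> ('f, 'v) trm set" where
  "subterms (Var x) = {Var x}"
| "subterms (Fun f ts) = insert (Fun f ts) (\<Union>t\<in>set ts. subterms t)"

text \<open>Equality is the only predicate (other predicates being encoded, as usual, by functions into a
  sort of truth values). Equations are unordered pairs.\<close>

datatype 'a literal = Pos "'a uprod" | Neg "'a uprod"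

type_synonym ('f, 'v) equation = "('f, 'v) trm uprod"
type_synonym ('f, 'v) lit = "('f, 'v) trm literal"
type_synonym ('f, 'v) clause = "('f, 'v) lit multiset"

primrec compl_lit :: "'a literal \<Rightarrow> 'a literal" where
  "compl_lit (Pos e) = Neg e"
| "compl_lit (Neg e) = Pos e"

definition subst_lit :: "('f, 'v) lit \<Rightarrow> ('f, 'v, 'w) subst \<Rightarrow> ('f, 'w) lit" (infixl "\<cdot>l" 67) where
  "L \<cdot>l \<theta> = map_literal (\<lambda>s. s \<cdot> \<theta>) L"

definition vars_lit :: "('f, 'v) lit \<Rightarrow> 'v set" where
  "vars_lit L = (\<Union>s\<in>set_literal L. vars_trm s)"

definition vars_clause :: "('f, 'v) clause \<Rightarrow> 'v set" where
  "vars_clause C = (\<Union>L\<in>set_mset C. vars_lit L)"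

definition eq_clause :: "('f, 'v) equation \<Rightarrow> ('f, 'v) clause" where
  "eq_clause e = {#Pos e#}"

text \<open>A side of an equation is already a strict subterm of the literal.\<close>

definition strict_subterm_lit :: "('f, 'v) trm \<Rightarrow> ('f, 'v) lit \<Rightarrow> bool" where
  "strict_subterm_lit s L \<longleftrightarrow> (\<exists>u\<in>set_literal L. s \<in> subterms u)"


section \<open>Distinguished occurrences\<close>

text \<open>An expression \<open>E[s]\<close> with distinguished occurrences of \<open>s\<close> is represented by an expression over
  the variables \<open>'v option\<close>, in which \<open>None\<close> marks the distinguished places (\<open>hole_lit\<close>,
  \<open>hole_clause\<close>: there is at least one). Thus \<open>E[s]\<close> is the filling with \<open>s\<close>, and
  \<open>E[s \<mapsto> t]\<close> the filling of the same pattern with \<open>t\<close>.\<close>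

definition fill_lit :: "('f, 'v option) lit \<Rightarrow> ('f, 'v) trm \<Rightarrow> ('f, 'v) lit" where
  "fill_lit K s = K \<cdot>l case_option s Var"

definition fill_clause :: "('f, 'v option) clause \<Rightarrow> ('f, 'v) trm \<Rightarrow> ('f, 'v) clause" where
  "fill_clause D s = image_mset (\<lambda>K. fill_lit K s) D"

definition hole_lit :: "('f, 'v option) lit \<Rightarrow> bool" where
  "hole_lit K \<longleftrightarrow> None \<in> vars_lit K"

definition hole_clause :: "('f, 'v option) clause \<Rightarrow> bool" where
  "hole_clause D \<longleftrightarrow> None \<in> vars_clause D"

text \<open>Substitution for the proper variables of a pattern, keeping the distinguished places.\<close>

definition lift_subst :: "('f, 'v, 'w) subst \<Rightarrow> ('f, 'v option, 'w option) subst" where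
  "lift_subst \<theta> = case_option (Var None) (\<lambda>y. map_trm id Some (\<theta> y))"


section \<open>Sorts\<close>

record ('f, 'v, 'p, 's) signature =
  arg_sorts :: "'f \<Rightarrow> 's list"
  res_sort :: "'f \<Rightarrow> 's"
  var_sort :: "'v \<Rightarrow> 's"
  pred_sorts :: "'p \<Rightarrow> 's list"  \<comment> \<open>argument sorts of second-order (predicate) variables\<close>

inductive has_sort :: "('f, 'v, 'p, 's) signature \<Rightarrow> ('f, 'v) trm \<Rightarrow> 's \<Rightarrow> bool"
  for \<Sigma> :: "('f, 'v, 'p, 's) signature" where
  "has_sort \<Sigma> (Var x) (var_sort \<Sigma> x)"
| "list_all2 (has_sort \<Sigma>) ts (arg_sorts \<Sigma> f) \<Longrightarrow> has_sort \<Sigma> (Fun f ts) (res_sort \<Sigma> f)"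

definition wf_trm :: "('f, 'v, 'p, 's) signature \<Rightarrow> ('f, 'v) trm \<Rightarrow> bool" where
  "wf_trm \<Sigma> t \<longleftrightarrow> (\<exists>s. has_sort \<Sigma> t s)"

definition wf_eq :: "('f, 'v, 'p, 's) signature \<Rightarrow> ('f, 'v) equation \<Rightarrow> bool" where
  "wf_eq \<Sigma> e \<longleftrightarrow> (\<exists>s. \<forall>t\<in>set_uprod e. has_sort \<Sigma> t s)"

primrec wf_lit :: "('f, 'v, 'p, 's) signature \<Rightarrow> ('f, 'v) lit \<Rightarrow> bool" where
  "wf_lit \<Sigma> (Pos e) = wf_eq \<Sigma> e"
| "wf_lit \<Sigma> (Neg e) = wf_eq \<Sigma> e"

definition wf_clause :: "('f, 'v, 'p, 's) signature \<Rightarrow> ('f, 'v) clause \<Rightarrow> bool" where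
  "wf_clause \<Sigma> C \<longleftrightarrow> (\<forall>L\<in>#C. wf_lit \<Sigma> L)"

definition wf_subst :: "('f, 'v, 'p, 's) signature \<Rightarrow> ('f, 'v, 'v) subst \<Rightarrow> bool" where
  "wf_subst \<Sigma> \<theta> \<longleftrightarrow> (\<forall>x. has_sort \<Sigma> (\<theta> x) (var_sort \<Sigma> x))"


section \<open>Reduction orderings\<close>

definition reduction_ordering ::
    "('f, 'v, 'p, 's) signature \<Rightarrow> (('f, 'v) trm \<Rightarrow> ('f, 'v) trm \<Rightarrow> bool) \<Rightarrow> bool" where
  "reduction_ordering \<Sigma> gt \<longleftrightarrow>
     transp_on {t. wf_trm \<Sigma> t} gt \<and>
     wfp_on {t. wf_trm \<Sigma> t} (\<lambda>s t. gt t s) \<and>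
     (\<forall>s t \<theta>. wf_trm \<Sigma> s \<and> wf_trm \<Sigma> t \<and> wf_subst \<Sigma> \<theta> \<and> gt s t \<longrightarrow> gt (s \<cdot> \<theta>) (t \<cdot> \<theta>)) \<and>
     (\<forall>f us s t vs. wf_trm \<Sigma> (Fun f (us @ s # vs)) \<and> wf_trm \<Sigma> (Fun f (us @ t # vs)) \<and> gt s t \<longrightarrow>
        gt (Fun f (us @ s # vs)) (Fun f (us @ t # vs))) \<and>
     totalp_on {t. wf_trm \<Sigma> t \<and> vars_trm t = {}} gt"

text \<open>Only ground terms are below ground terms. With a single sort every reduction ordering has this
  property (\<open>ground_below_ground_single_sorted\<close>). With several sorts it is a special case of the usual
  variable condition \<open>vars t \<subseteq> vars s\<close> for \<open>s \<succ> t\<close>, and it can fail: for \<open>a : \<alpha>\<close>,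
  \<open>b : \<tau>\<close>, \<open>f : \<tau> \<rightarrow> \<alpha>\<close> and \<open>y : \<tau>\<close> nothing prevents
  \<open>a \<succ> f(y)\<close>.\<close>

definition ground_below_ground ::
    "('f, 'v, 'p, 's) signature \<Rightarrow> (('f, 'v) trm \<Rightarrow> ('f, 'v) trm \<Rightarrow> bool) \<Rightarrow> bool" where
  "ground_below_ground \<Sigma> gt \<longleftrightarrow>
     (\<forall>s t. wf_trm \<Sigma> s \<and> wf_trm \<Sigma> t \<and> vars_trm s = {} \<and> gt s t \<longrightarrow> vars_trm t = {})"

lemma has_sort_subst:
  fixes \<Sigma> :: "('f, 'v, 'p, 's) signature"
  assumes "wf_subst \<Sigma> \<theta>"
  shows "has_sort \<Sigma> t s \<Longrightarrow> has_sort \<Sigma> (t \<cdot> \<theta>) s"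
proof (induction rule: has_sort.induct)
  case (1 x)
  then show ?case using assms by (simp add: wf_subst_def)
next
  case (2 ts f)
  then have "list_all2 (has_sort \<Sigma>) (map (\<lambda>t. t \<cdot> \<theta>) ts) (arg_sorts \<Sigma> f)"
    by (auto simp: list_all2_conv_all_nth)
  then show ?case by (simp add: has_sort.intros)
qed

lemma subst_trm_cong: "(\<And>x. x \<in> vars_trm t \<Longrightarrow> \<theta> x = \<tau> x) \<Longrightarrow> t \<cdot> \<theta> = t \<cdot> \<tau>"
  by (induction t) auto

lemma subst_trm_Var: "t \<cdot> Var = t"
  by (induction t) (auto intro: map_idI)

lemma gt_Fun:
  fixes \<Sigma> :: "('f, 'v, 'p, 's) signature"
  assumes ro: "reduction_ordering \<Sigma> gt"
  shows "list_all2 (has_sort \<Sigma>) (ps @ us) (arg_sorts \<Sigma> f) \<Longrightarrow>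
    list_all2 (has_sort \<Sigma>) (ps @ vs) (arg_sorts \<Sigma> f) \<Longrightarrow>
    list_all2 (\<lambda>u v. u = v \<or> gt u v) us vs \<Longrightarrow> us = vs \<or> gt (Fun f (ps @ us)) (Fun f (ps @ vs))"
proof (induction us arbitrary: ps vs)
  case Nil
  then show ?case by simp
next
  case (Cons u us)
  then obtain v ws where vs: "vs = v # ws" and uv: "u = v \<or> gt u v"
    and ws: "list_all2 (\<lambda>u v. u = v \<or> gt u v) us ws"
    by (auto simp: list_all2_Cons1)
  have mid: "list_all2 (has_sort \<Sigma>) ((ps @ [v]) @ us) (arg_sorts \<Sigma> f)"
  proof -
    have "((ps @ [v]) @ us) ! i = (if i \<le> length ps then (ps @ v # ws) ! i else (ps @ u # us) ! i)" for i
      by (auto simp: nth_append nth_Cons')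
    then show ?thesis
      using Cons.prems(1,2) unfolding vs list_all2_conv_all_nth by simp
  qed
  have wf: "wf_trm \<Sigma> (Fun f (ps @ u # us))" "wf_trm \<Sigma> (Fun f (ps @ v # us))"
    "wf_trm \<Sigma> (Fun f (ps @ v # ws))"
    using Cons.prems(1,2) mid unfolding vs wf_trm_def by (auto intro: has_sort.intros)
  have 1: "u = v \<or> gt (Fun f (ps @ u # us)) (Fun f (ps @ v # us))"
    using uv wf(1,2) ro unfolding reduction_ordering_def by blast
  have 2: "us = ws \<or> gt (Fun f (ps @ v # us)) (Fun f (ps @ v # ws))"
    using Cons.IH[of "ps @ [v]" ws] mid Cons.prems(2) ws unfolding vs by simp
  have "transp_on {t. wf_trm \<Sigma> t} gt" using ro unfolding reduction_ordering_def by blast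
  then show ?case using 1 2 wf unfolding vs by (auto dest: transp_onD)
qed

lemma gt_subst_mono:
  fixes \<Sigma> :: "('f, 'v, 'p, 's) signature"
  assumes ro: "reduction_ordering \<Sigma> gt"
    and ab: "has_sort \<Sigma> a (var_sort \<Sigma> y)" "has_sort \<Sigma> b (var_sort \<Sigma> y)" "gt a b"
  shows "has_sort \<Sigma> t s \<Longrightarrow> t \<cdot> sing y a = t \<cdot> sing y b \<or> gt (t \<cdot> sing y a) (t \<cdot> sing y b)"
proof (induction rule: has_sort.induct)
  case (1 x)
  then show ?case using ab by simp
next
  case (2 ts f)
  have wfs: "wf_subst \<Sigma> (sing y a)" "wf_subst \<Sigma> (sing y b)"
    using ab by (auto simp: wf_subst_def intro: has_sort.intros)
  have "list_all2 (has_sort \<Sigma>) (map (\<lambda>t. t \<cdot> sing y c) ts) (arg_sorts \<Sigma> f)"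
    if "wf_subst \<Sigma> (sing y c)" for c
    using 2 has_sort_subst[OF that] by (auto simp: list_all2_conv_all_nth)
  moreover have "list_all2 (\<lambda>u v. u = v \<or> gt u v)
      (map (\<lambda>t. t \<cdot> sing y a) ts) (map (\<lambda>t. t \<cdot> sing y b) ts)"
    using 2 unfolding list_all2_conv_all_nth by (simp del: fun_upd_apply)
  ultimately show ?case
    using gt_Fun[OF ro, of "[]" "map (\<lambda>t. t \<cdot> sing y a) ts" f "map (\<lambda>t. t \<cdot> sing y b) ts"] wfs
    by (simp only: append_Nil subst_trm.simps) metis
qed

lemma ground_below_ground_single_sorted:
  fixes \<Sigma> :: "('f, 'v, 'p, 's) signature"
  assumes ro: "reduction_ordering \<Sigma> gt" and one: "\<And>s s' :: 's. s = s'"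
  shows "ground_below_ground \<Sigma> gt"
  unfolding ground_below_ground_def
proof (intro allI impI, elim conjE, rule ccontr)
  fix s t assume wf: "wf_trm \<Sigma> s" "wf_trm \<Sigma> t" and gr: "vars_trm s = {}" and st: "gt s t"
    and "vars_trm t \<noteq> {}"
  then obtain y where y: "y \<in> vars_trm t" by blast
  define a where "a = rec_nat s (\<lambda>_ u. t \<cdot> sing y u)"
  have a: "a 0 = s" "\<And>n. a (Suc n) = t \<cdot> sing y (a n)" by (auto simp: a_def)
  have srt: "has_sort \<Sigma> u \<tau>" if "wf_trm \<Sigma> u" for u \<tau>
  proof -
    from that obtain \<tau>' where "has_sort \<Sigma> u \<tau>'" by (auto simp: wf_trm_def)
    moreover have "\<tau>' = \<tau>" by (rule one)
    ultimately show ?thesis by simp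
  qed
  have wfs: "wf_subst \<Sigma> (sing y u)" if "wf_trm \<Sigma> u" for u
    using srt[OF that] by (auto simp: wf_subst_def intro: has_sort.intros)
  have wfa: "wf_trm \<Sigma> (a n)" for n
  proof (induction n)
    case 0
    then show ?case using wf by (simp add: a)
  next
    case (Suc n)
    then show ?case
      using has_sort_subst[OF wfs[OF Suc] srt[OF wf(2)]] by (auto simp: a wf_trm_def)
  qed
  have W: "wfp_on {t. wf_trm \<Sigma> t} (\<lambda>s t. gt t s)" using ro unfolding reduction_ordering_def by blast
  have irr: "\<not> gt u u" if "wf_trm \<Sigma> u" for u
    using W that
  proof (induction u rule: wfp_on_induct)
    case (less u)
    then show ?case using that by blast
  qed (simp add: that)
  have inj: "u \<cdot> sing y c = u \<cdot> sing y d \<Longrightarrow> y \<in> vars_trm u \<Longrightarrow> c = d" for u c d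
  proof (induction u)
    case (Fun f us)
    from Fun.prems(2) obtain u where u: "u \<in> set us" "y \<in> vars_trm u" by auto
    with Fun.prems(1) have "u \<cdot> sing y c = u \<cdot> sing y d" by (simp del: fun_upd_apply)
    with Fun.IH u show ?case by blast
  qed auto
  have step: "gt (a n) (a (Suc n))" for n
  proof (induction n)
    case 0
    have "gt (s \<cdot> sing y s) (t \<cdot> sing y s)"
      using ro wf st wfs[OF wf(1)] unfolding reduction_ordering_def by blast
    moreover have "s \<cdot> sing y s = s"
      using subst_trm_cong[of s "sing y s" Var] gr by (simp add: subst_trm_Var)
    ultimately show ?case by (simp add: a)
  next
    case (Suc n)
    have "a n \<noteq> a (Suc n)"
      using Suc irr[OF wfa[of n]] by auto
    then have "t \<cdot> sing y (a n) \<noteq> t \<cdot> sing y (a (Suc n))"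
      using inj[OF _ y] by blast
    moreover have "has_sort \<Sigma> t (var_sort \<Sigma> y)" by (rule srt[OF wf(2)])
    ultimately have "gt (t \<cdot> sing y (a n)) (t \<cdot> sing y (a (Suc n)))"
      using gt_subst_mono[OF ro srt[OF wfa] srt[OF wfa] Suc] by blast
    then show ?case by (simp only: a(2))
  qed
  have "\<forall>n. u \<noteq> a n" if "wf_trm \<Sigma> u" for u
    using W that
  proof (induction u rule: wfp_on_induct)
    case (less u)
    then show ?case using step wfa by blast
  qed (simp add: that)
  then show False using wfa by blast
qed

text \<open>Bag extensions: \<open>s \<simeq> t\<close> is compared as \<open>{s, t}\<close> and its negation as
  \<open>{s, s, t, t}\<close>.\<close>

lift_definition mset_uprod :: "'a uprod \<Rightarrow> 'a multiset" is "\<lambda>(a, b). {#a, b#}"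
  by (auto simp: add_mset_commute)

primrec mset_lit :: "'a literal \<Rightarrow> 'a multiset" where
  "mset_lit (Pos e) = mset_uprod e"
| "mset_lit (Neg e) = mset_uprod e + mset_uprod e"

definition lit_gt :: "(('f, 'v) trm \<Rightarrow> ('f, 'v) trm \<Rightarrow> bool) \<Rightarrow> ('f, 'v) lit \<Rightarrow> ('f, 'v) lit \<Rightarrow> bool" where
  "lit_gt gt L K \<longleftrightarrow> multp (\<lambda>s t. gt t s) (mset_lit K) (mset_lit L)"

definition clause_gt ::
    "(('f, 'v) trm \<Rightarrow> ('f, 'v) trm \<Rightarrow> bool) \<Rightarrow> ('f, 'v) clause \<Rightarrow> ('f, 'v) clause \<Rightarrow> bool" where
  "clause_gt gt C D \<longleftrightarrow> multp (\<lambda>K L. lit_gt gt L K) D C"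


section \<open>Second-order formulas\<close>

text \<open>Atomic formulas are clauses (disjunctions of literals, so that in particular literals and
  equations are formulas) and applications of second-order variables.\<close>

datatype ('f, 'v, 'p) fm =
    FClause "('f, 'v) clause"
  | FPred 'p "('f, 'v) trm list"
  | FNeg "('f, 'v, 'p) fm"
  | FAnd "('f, 'v, 'p) fm" "('f, 'v, 'p) fm"
  | FOr "('f, 'v, 'p) fm" "('f, 'v, 'p) fm"
  | FImp "('f, 'v, 'p) fm" "('f, 'v, 'p) fm"
  | FAll 'v "('f, 'v, 'p) fm"
  | FEx 'v "('f, 'v, 'p) fm"
  | FAllP 'p "('f, 'v, 'p) fm"
  | FExP 'p "('f, 'v, 'p) fm"

primrec wf_fm :: "('f, 'v, 'p, 's) signature \<Rightarrow> ('f, 'v, 'p) fm \<Rightarrow> bool" where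
  "wf_fm \<Sigma> (FClause C) \<longleftrightarrow> wf_clause \<Sigma> C"
| "wf_fm \<Sigma> (FPred Q ts) \<longleftrightarrow> list_all2 (has_sort \<Sigma>) ts (pred_sorts \<Sigma> Q)"
| "wf_fm \<Sigma> (FNeg A) \<longleftrightarrow> wf_fm \<Sigma> A"
| "wf_fm \<Sigma> (FAnd A B) \<longleftrightarrow> wf_fm \<Sigma> A \<and> wf_fm \<Sigma> B"
| "wf_fm \<Sigma> (FOr A B) \<longleftrightarrow> wf_fm \<Sigma> A \<and> wf_fm \<Sigma> B"
| "wf_fm \<Sigma> (FImp A B) \<longleftrightarrow> wf_fm \<Sigma> A \<and> wf_fm \<Sigma> B"
| "wf_fm \<Sigma> (FAll y A) \<longleftrightarrow> wf_fm \<Sigma> A"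
| "wf_fm \<Sigma> (FEx y A) \<longleftrightarrow> wf_fm \<Sigma> A"
| "wf_fm \<Sigma> (FAllP Q A) \<longleftrightarrow> wf_fm \<Sigma> A"
| "wf_fm \<Sigma> (FExP Q A) \<longleftrightarrow> wf_fm \<Sigma> A"

primrec free_preds :: "('f, 'v, 'p) fm \<Rightarrow> 'p set" where
  "free_preds (FClause C) = {}"
| "free_preds (FPred Q ts) = {Q}"
| "free_preds (FNeg A) = free_preds A"
| "free_preds (FAnd A B) = free_preds A \<union> free_preds B"
| "free_preds (FOr A B) = free_preds A \<union> free_preds B"
| "free_preds (FImp A B) = free_preds A \<union> free_preds B"
| "free_preds (FAll y A) = free_preds A"
| "free_preds (FEx y A) = free_preds A"
| "free_preds (FAllP Q A) = free_preds A - {Q}"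
| "free_preds (FExP Q A) = free_preds A - {Q}"

primrec first_order :: "('f, 'v, 'p) fm \<Rightarrow> bool" where
  "first_order (FClause C) \<longleftrightarrow> True"
| "first_order (FPred Q ts) \<longleftrightarrow> False"
| "first_order (FNeg A) \<longleftrightarrow> first_order A"
| "first_order (FAnd A B) \<longleftrightarrow> first_order A \<and> first_order B"
| "first_order (FOr A B) \<longleftrightarrow> first_order A \<and> first_order B"
| "first_order (FImp A B) \<longleftrightarrow> first_order A \<and> first_order B"
| "first_order (FAll y A) \<longleftrightarrow> first_order A"
| "first_order (FEx y A) \<longleftrightarrow> first_order A"
| "first_order (FAllP Q A) \<longleftrightarrow> False"
| "first_order (FExP Q A) \<longleftrightarrow> False"

text \<open>\<open>inst_pred P x L G\<close> is \<open>G[L[x]]\<close>: every free atom \<open>P(u)\<close> of \<open>G\<close>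
  becomes \<open>L[u]\<close>. It is only used for literals \<open>L\<close> with no variable other than \<open>x\<close>,
  so the quantifiers of \<open>G\<close> capture nothing.\<close>

primrec inst_pred :: "'p \<Rightarrow> 'v \<Rightarrow> ('f, 'v) lit \<Rightarrow> ('f, 'v, 'p) fm \<Rightarrow> ('f, 'v, 'p) fm" where
  "inst_pred P x L (FClause C) = FClause C"
| "inst_pred P x L (FPred Q ts) =
     (case ts of
        [u] \<Rightarrow> if Q = P then FClause {#L \<cdot>l sing x u#} else FPred Q ts
      | _ \<Rightarrow> FPred Q ts)"
| "inst_pred P x L (FNeg A) = FNeg (inst_pred P x L A)"
| "inst_pred P x L (FAnd A B) = FAnd (inst_pred P x L A) (inst_pred P x L B)"
| "inst_pred P x L (FOr A B) = FOr (inst_pred P x L A) (inst_pred P x L B)"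
| "inst_pred P x L (FImp A B) = FImp (inst_pred P x L A) (inst_pred P x L B)"
| "inst_pred P x L (FAll y A) = FAll y (inst_pred P x L A)"
| "inst_pred P x L (FEx y A) = FEx y (inst_pred P x L A)"
| "inst_pred P x L (FAllP Q A) = FAllP Q (if Q = P then A else inst_pred P x L A)"
| "inst_pred P x L (FExP Q A) = FExP Q (if Q = P then A else inst_pred P x L A)"


section \<open>Semantics\<close>

record ('f, 's, 'd) interp =
  univ :: "'s \<Rightarrow> 'd set"
  fun_int :: "'f \<Rightarrow> 'd list \<Rightarrow> 'd"

definition is_interp :: "('f, 'v, 'p, 's) signature \<Rightarrow> ('f, 's, 'd) interp \<Rightarrow> bool" where
  "is_interp \<Sigma> M \<longleftrightarrow>
     (\<forall>s. univ M s \<noteq> {}) \<and>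
     (\<forall>f ds. list_all2 (\<lambda>d s. d \<in> univ M s) ds (arg_sorts \<Sigma> f) \<longrightarrow> fun_int M f ds \<in> univ M (res_sort \<Sigma> f))"

primrec eval_trm :: "('f, 's, 'd) interp \<Rightarrow> ('v \<Rightarrow> 'd) \<Rightarrow> ('f, 'v) trm \<Rightarrow> 'd" where
  "eval_trm M \<alpha> (Var x) = \<alpha> x"
| "eval_trm M \<alpha> (Fun f ts) = fun_int M f (map (eval_trm M \<alpha>) ts)"

primrec sat_lit :: "('f, 's, 'd) interp \<Rightarrow> ('v \<Rightarrow> 'd) \<Rightarrow> ('f, 'v) lit \<Rightarrow> bool" where
  "sat_lit M \<alpha> (Pos e) \<longleftrightarrow> (\<forall>s t. e = Upair s t \<longrightarrow> eval_trm M \<alpha> s = eval_trm M \<alpha> t)"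
| "sat_lit M \<alpha> (Neg e) \<longleftrightarrow> (\<forall>s t. e = Upair s t \<longrightarrow> eval_trm M \<alpha> s \<noteq> eval_trm M \<alpha> t)"

primrec sat :: "('f, 'v, 'p, 's) signature \<Rightarrow> ('f, 's, 'd) interp \<Rightarrow> ('f, 'v, 'p) fm \<Rightarrow>
    ('v \<Rightarrow> 'd) \<Rightarrow> ('p \<Rightarrow> 'd list set) \<Rightarrow> bool" where
  "sat \<Sigma> M (FClause C) = (\<lambda>\<alpha> \<beta>. \<exists>L\<in>#C. sat_lit M \<alpha> L)"
| "sat \<Sigma> M (FPred Q ts) = (\<lambda>\<alpha> \<beta>. map (eval_trm M \<alpha>) ts \<in> \<beta> Q)"
| "sat \<Sigma> M (FNeg A) = (\<lambda>\<alpha> \<beta>. \<not> sat \<Sigma> M A \<alpha> \<beta>)"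
| "sat \<Sigma> M (FAnd A B) = (\<lambda>\<alpha> \<beta>. sat \<Sigma> M A \<alpha> \<beta> \<and> sat \<Sigma> M B \<alpha> \<beta>)"
| "sat \<Sigma> M (FOr A B) = (\<lambda>\<alpha> \<beta>. sat \<Sigma> M A \<alpha> \<beta> \<or> sat \<Sigma> M B \<alpha> \<beta>)"
| "sat \<Sigma> M (FImp A B) = (\<lambda>\<alpha> \<beta>. sat \<Sigma> M A \<alpha> \<beta> \<longrightarrow> sat \<Sigma> M B \<alpha> \<beta>)"
| "sat \<Sigma> M (FAll y A) = (\<lambda>\<alpha> \<beta>. \<forall>d\<in>univ M (var_sort \<Sigma> y). sat \<Sigma> M A (\<alpha>(y := d)) \<beta>)"
| "sat \<Sigma> M (FEx y A) = (\<lambda>\<alpha> \<beta>. \<exists>d\<in>univ M (var_sort \<Sigma> y). sat \<Sigma> M A (\<alpha>(y := d)) \<beta>)"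
| "sat \<Sigma> M (FAllP Q A) = (\<lambda>\<alpha> \<beta>. \<forall>R. sat \<Sigma> M A \<alpha> (\<beta>(Q := R)))"
| "sat \<Sigma> M (FExP Q A) = (\<lambda>\<alpha> \<beta>. \<exists>R. sat \<Sigma> M A \<alpha> (\<beta>(Q := R)))"

text \<open>Free variables are implicitly universally quantified.\<close>

definition true_in :: "('f, 'v, 'p, 's) signature \<Rightarrow> ('f, 's, 'd) interp \<Rightarrow> ('f, 'v, 'p) fm \<Rightarrow> bool" where
  "true_in \<Sigma> M A \<longleftrightarrow> (\<forall>\<alpha> \<beta>. (\<forall>x. \<alpha> x \<in> univ M (var_sort \<Sigma> x)) \<longrightarrow> sat \<Sigma> M A \<alpha> \<beta>)"

definition satisfiable ::
    "'d itself \<Rightarrow> ('f, 'v, 'p, 's) signature \<Rightarrow> ('f, 'v, 'p) fm set \<Rightarrow> bool" where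
  "satisfiable U \<Sigma> S \<longleftrightarrow>
     (\<exists>M :: ('f, 's, 'd) interp. is_interp \<Sigma> M \<and> (\<forall>A\<in>S. true_in \<Sigma> M A))"

text \<open>Skolem functions are taken from the function symbols \<open>'f\<close>, so the signature is understood to
  contain all symbols that \<open>cnf\<close> may introduce.\<close>

definition is_cnf ::
    "'d itself \<Rightarrow> ('f, 'v, 'p, 's) signature \<Rightarrow> (('f, 'v, 'p) fm \<Rightarrow> ('f, 'v) clause set) \<Rightarrow> bool" where
  "is_cnf U \<Sigma> cnf \<longleftrightarrow>
     (\<forall>A. wf_fm \<Sigma> A \<and> first_order A \<longrightarrow>
        (\<forall>C\<in>cnf A. wf_clause \<Sigma> C) \<and>
        (satisfiable U \<Sigma> (FClause ` cnf A :: ('f, 'v, 'p) fm set) \<longleftrightarrow> satisfiable U \<Sigma> {A}))"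

text \<open>\<open>\<forall>P. (G[P] \<longrightarrow> \<forall>y. P[y])\<close> is valid in the class \<open>\<M>\<close> of intended structures
  (e.g. all structures, or those interpreting a sort as a term algebra).\<close>

definition valid_induction_schema ::
    "('f, 'v, 'p, 's) signature \<Rightarrow> ('f, 's, 'd) interp set \<Rightarrow> 'p \<Rightarrow> ('f, 'v, 'p) fm \<Rightarrow> bool" where
  "valid_induction_schema \<Sigma> \<M> P G \<longleftrightarrow>
     wf_fm \<Sigma> G \<and> free_preds G = {P} \<and> length (pred_sorts \<Sigma> P) = 1 \<and>
     (\<forall>M\<in>\<M>. is_interp \<Sigma> M \<and>
        (\<forall>y. pred_sorts \<Sigma> P = [var_sort \<Sigma> y] \<longrightarrow>
           true_in \<Sigma> M (FAllP P (FImp G (FAll y (FPred P [Var y]))))))"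


section \<open>Inference systems\<close>

text \<open>An inference has a list of premises and a set of conclusions, since \<open>cnf\<close> yields a set.\<close>

type_synonym ('f, 'v) inference = "('f, 'v) clause list \<times> ('f, 'v) clause set"

inductive derivable ::
    "('f, 'v) inference set \<Rightarrow> ('f, 'v) clause set \<Rightarrow> ('f, 'v) clause \<Rightarrow> bool"
  for I :: "('f, 'v) inference set" and S :: "('f, 'v) clause set" where
  "D \<in> S \<Longrightarrow> derivable I S D"
| "(Ps, Cs) \<in> I \<Longrightarrow> \<forall>Q\<in>set Ps. derivable I S Q \<Longrightarrow> D \<in> Cs \<Longrightarrow> derivable I S D"

definition admits_ED :: "('f, 'v, 'p, 's) signature \<Rightarrow> ('f, 'v) inference set \<Rightarrow> bool" where
  "admits_ED \<Sigma> I \<longleftrightarrow>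
     (\<forall>\<theta> \<C> l r D.
        wf_subst \<Sigma> \<theta> \<and> (\<forall>e\<in>\<C>. wf_eq \<Sigma> e) \<and> wf_eq \<Sigma> (Upair l r) \<and>
        hole_clause D \<and> wf_clause \<Sigma> (fill_clause D (l \<cdot> \<theta>)) \<longrightarrow>
        derivable I (eq_clause ` \<C>) (fill_clause D (l \<cdot> \<theta>)) \<longrightarrow>
        derivable I (eq_clause ` insert (Upair l r) \<C>) (fill_clause D (r \<cdot> \<theta>)))"

text \<open>Side conditions of the inference of \<open>cnf(\<not> G[L[x]] \<or> C)\<close> from
  \<open>compl L[t] \<or> C\<close>. As \<open>L[t]\<close> is \<open>L\<close> with \<open>t\<close> substituted for \<open>x\<close>, the
  distinguished occurrences of \<open>t\<close> are the places of \<open>x\<close> in \<open>L\<close>; having none is not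
  excluded.\<close>

definition Ind_applicable ::
    "('f, 'v, 'p, 's) signature \<Rightarrow> ('f, 'v) trm set \<Rightarrow> 'p \<Rightarrow>
     ('f, 'v) lit \<Rightarrow> 'v \<Rightarrow> ('f, 'v) trm \<Rightarrow> ('f, 'v) clause \<Rightarrow> bool" where
  "Ind_applicable \<Sigma> IndT P L x t C \<longleftrightarrow>
     wf_lit \<Sigma> L \<and> wf_clause \<Sigma> C \<and> has_sort \<Sigma> t (var_sort \<Sigma> x) \<and> pred_sorts \<Sigma> P = [var_sort \<Sigma> x] \<and>
     x \<notin> vars_trm t \<union> vars_clause C \<and>
     vars_lit (L \<cdot>l sing x t) = {} \<and> t \<in> IndT"

definition Ind_premise ::
    "('f, 'v) lit \<Rightarrow> 'v \<Rightarrow> ('f, 'v) trm \<Rightarrow> ('f, 'v) clause \<Rightarrow> ('f, 'v) clause" where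
  "Ind_premise L x t C = add_mset (compl_lit (L \<cdot>l sing x t)) C"

definition Ind_formula ::
    "'p \<Rightarrow> ('f, 'v, 'p) fm \<Rightarrow> ('f, 'v) lit \<Rightarrow> 'v \<Rightarrow> ('f, 'v) clause \<Rightarrow> ('f, 'v, 'p) fm" where
  "Ind_formula P G L x C = FOr (FNeg (inst_pred P x L G)) (FClause C)"

definition Ind_inference ::
    "('f, 'v, 'p, 's) signature \<Rightarrow> ('f, 'v) trm set \<Rightarrow> 'p \<Rightarrow> ('f, 'v, 'p) fm \<Rightarrow>
     ('f, 'v) clause \<Rightarrow> ('f, 'v, 'p) fm \<Rightarrow> bool" where
  "Ind_inference \<Sigma> IndT P G D A \<longleftrightarrow>
     (\<exists>L x t C. Ind_applicable \<Sigma> IndT P L x t C \<and> D = Ind_premise L x t C \<and> A = Ind_formula P G L x C)"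

definition Ind_rule ::
    "('f, 'v, 'p, 's) signature \<Rightarrow> ('f, 'v) trm set \<Rightarrow> (('f, 'v, 'p) fm \<Rightarrow> ('f, 'v) clause set) \<Rightarrow>
     'p \<Rightarrow> ('f, 'v, 'p) fm \<Rightarrow> ('f, 'v) inference set" where
  "Ind_rule \<Sigma> IndT cnf P G = {([D], cnf A) | D A. Ind_inference \<Sigma> IndT P G D A}"


section \<open>Redundant induction inferences\<close>

inductive rw_trm ::
    "('f, 'v, 'p, 's) signature \<Rightarrow> ('f, 'v) equation set \<Rightarrow> ('f, 'v) trm \<Rightarrow> ('f, 'v) trm \<Rightarrow> bool"
  for \<Sigma> :: "('f, 'v, 'p, 's) signature" and E :: "('f, 'v) equation set" where
  "Upair u v \<in> E \<Longrightarrow> wf_subst \<Sigma> \<rho> \<Longrightarrow> rw_trm \<Sigma> E (u \<cdot> \<rho>) (v \<cdot> \<rho>)"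
| "rw_trm \<Sigma> E s t \<Longrightarrow> rw_trm \<Sigma> E (Fun f (us @ s # vs)) (Fun f (us @ t # vs))"

inductive rw_lit ::
    "('f, 'v, 'p, 's) signature \<Rightarrow> ('f, 'v) equation set \<Rightarrow> ('f, 'v) lit \<Rightarrow> ('f, 'v) lit \<Rightarrow> bool"
  for \<Sigma> :: "('f, 'v, 'p, 's) signature" and E :: "('f, 'v) equation set" where
  "rw_trm \<Sigma> E s t \<Longrightarrow> rw_lit \<Sigma> E (Pos (Upair s u)) (Pos (Upair t u))"
| "rw_trm \<Sigma> E s t \<Longrightarrow> rw_lit \<Sigma> E (Neg (Upair s u)) (Neg (Upair t u))"

inductive rw_fm ::
    "('f, 'v, 'p, 's) signature \<Rightarrow> ('f, 'v) equation set \<Rightarrow> ('f, 'v, 'p) fm \<Rightarrow> ('f, 'v, 'p) fm \<Rightarrow> bool"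
  for \<Sigma> :: "('f, 'v, 'p, 's) signature" and E :: "('f, 'v) equation set" where
  "rw_lit \<Sigma> E L K \<Longrightarrow> rw_fm \<Sigma> E (FClause (add_mset L C)) (FClause (add_mset K C))"
| "rw_trm \<Sigma> E s t \<Longrightarrow> rw_fm \<Sigma> E (FPred Q (us @ s # vs)) (FPred Q (us @ t # vs))"
| "rw_fm \<Sigma> E A B \<Longrightarrow> rw_fm \<Sigma> E (FNeg A) (FNeg B)"
| "rw_fm \<Sigma> E A B \<Longrightarrow> rw_fm \<Sigma> E (FAnd A H) (FAnd B H)"
| "rw_fm \<Sigma> E A B \<Longrightarrow> rw_fm \<Sigma> E (FAnd H A) (FAnd H B)"
| "rw_fm \<Sigma> E A B \<Longrightarrow> rw_fm \<Sigma> E (FOr A H) (FOr B H)"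
| "rw_fm \<Sigma> E A B \<Longrightarrow> rw_fm \<Sigma> E (FOr H A) (FOr H B)"
| "rw_fm \<Sigma> E A B \<Longrightarrow> rw_fm \<Sigma> E (FImp A H) (FImp B H)"
| "rw_fm \<Sigma> E A B \<Longrightarrow> rw_fm \<Sigma> E (FImp H A) (FImp H B)"
| "rw_fm \<Sigma> E A B \<Longrightarrow> rw_fm \<Sigma> E (FAll y A) (FAll y B)"
| "rw_fm \<Sigma> E A B \<Longrightarrow> rw_fm \<Sigma> E (FEx y A) (FEx y B)"
| "rw_fm \<Sigma> E A B \<Longrightarrow> rw_fm \<Sigma> E (FAllP Q A) (FAllP Q B)"
| "rw_fm \<Sigma> E A B \<Longrightarrow> rw_fm \<Sigma> E (FExP Q A) (FExP Q B)"

definition equiv_modulo ::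
    "('f, 'v, 'p, 's) signature \<Rightarrow> ('f, 'v) equation set \<Rightarrow> ('f, 'v, 'p) fm \<Rightarrow> ('f, 'v, 'p) fm \<Rightarrow> bool" where
  "equiv_modulo \<Sigma> E = equivclp (rw_fm \<Sigma> E)"

text \<open>The \<open>Ind\<^sub>G\<close> inference of \<open>cnf A\<close> from \<open>D\<close>, an inference of the system
  \<open>J\<close>, is redundant in \<open>J\<close> w.r.t. the equations \<open>E\<close> and the clause \<open>D'\<close>.\<close>

definition redundant_Ind ::
    "('f, 'v, 'p, 's) signature \<Rightarrow> (('f, 'v) trm \<Rightarrow> ('f, 'v) trm \<Rightarrow> bool) \<Rightarrow> ('f, 'v) trm set \<Rightarrow>
     (('f, 'v, 'p) fm \<Rightarrow> ('f, 'v) clause set) \<Rightarrow> 'p \<Rightarrow> ('f, 'v, 'p) fm \<Rightarrow> ('f, 'v) inference set \<Rightarrow>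
     ('f, 'v) equation set \<Rightarrow> ('f, 'v) clause \<Rightarrow> ('f, 'v) clause \<Rightarrow> ('f, 'v, 'p) fm \<Rightarrow> bool" where
  "redundant_Ind \<Sigma> gt IndT cnf P G J E D' D A \<longleftrightarrow>
     Ind_inference \<Sigma> IndT P G D A \<and> ([D], cnf A) \<in> J \<and>
     clause_gt gt D D' \<and>
     (\<exists>A'. Ind_inference \<Sigma> IndT P G D' A' \<and> ([D'], cnf A') \<in> J \<and> equiv_modulo \<Sigma> E A A')"

end

theory Submission
  imports Defs
begin

text \<open>Replacing the occurrences of \<open>l\<theta>\<close> in \<open>L[x]\<close> by \<open>r\<theta>\<close> gives a literal \<open>L'[x]\<close>, and
  \<open>L'[t]\<close> is \<open>L[t]\<close> with \<open>l\<sigma>\<close> replaced by \<open>r\<sigma>\<close>. Monotonicity of the ordering makes the premise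
  built from \<open>L'\<close> smaller. Its variables cause no problem: \<open>l\<sigma>\<close> is ground, hence so is the smaller
  term \<open>r\<sigma>\<close>. Every instance \<open>L[u]\<close> occurring in \<open>G[L[x]]\<close> rewrites to \<open>L'[u]\<close>, using
  \<open>l \<simeq> r\<close> under the substitution \<open>\<theta> \<cdot> {x \<mapsto> u}\<close>.\<close>

section \<open>Substitution in terms, literals and patterns with distinguished places\<close>

lemma subst_trm_comp: "t \<cdot> (\<theta> \<circ>\<^sub>s \<tau>) = t \<cdot> \<theta> \<cdot> \<tau>"
  by (induction t) (auto simp: comp_subst_def)

lemma subst_lit_comp: "K \<cdot>l (\<theta> \<circ>\<^sub>s \<tau>) = K \<cdot>l \<theta> \<cdot>l \<tau>"
  by (simp add: subst_lit_def literal.map_comp subst_trm_comp comp_def)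

lemma subst_trm_map_trm: "map_trm id h t \<cdot> \<tau> = t \<cdot> (\<lambda>y. \<tau> (h y))"
  by (induction t) auto

lemma vars_subst_trm: "vars_trm (t \<cdot> \<tau>) = (\<Union>y\<in>vars_trm t. vars_trm (\<tau> y))"
  by (induction t) auto

lemma vars_subst_lit: "vars_lit (K \<cdot>l \<tau>) = (\<Union>y\<in>vars_lit K. vars_trm (\<tau> y))"
  by (auto simp: vars_lit_def subst_lit_def literal.set_map vars_subst_trm)

lemma vars_compl_lit: "vars_lit (compl_lit L) = vars_lit L"
  by (cases L) (auto simp: vars_lit_def)

lemma compl_subst_lit: "compl_lit K \<cdot>l \<tau> = compl_lit (K \<cdot>l \<tau>)"
  by (cases K) (auto simp: subst_lit_def)

text \<open>\<open>lift_subst\<close> moves the variables of the substituted terms under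
  \<open>Some\<close>, and filling sends them back unchanged. This identifies the clause in the
  theorem, an instantiated pattern filled with \<open>r \<cdot> \<sigma>\<close>, with a premise of
  the induction rule.\<close>

lemma fill_lift_subst: "fill_lit (K \<cdot>l lift_subst \<theta>) s = K \<cdot>l case_option s \<theta>"
proof -
  have "lift_subst \<theta> \<circ>\<^sub>s case_option s Var = case_option s \<theta>"
    by (auto simp: comp_subst_def lift_subst_def subst_trm_map_trm subst_trm_Var split: option.splits)
  then show ?thesis by (simp add: fill_lit_def subst_lit_comp[symmetric])
qed

text \<open>Turns instances of two fillings of one pattern into instances of that pattern under
  substitutions differing at most at \<open>None\<close>, the form in which the ordering and
  rewriting lemmas compare them.\<close>

lemma subst_fill_lit: "fill_lit K s \<cdot>l \<tau> = K \<cdot>l case_option (s \<cdot> \<tau>) \<tau>"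
proof -
  have "case_option s Var \<circ>\<^sub>s \<tau> = case_option (s \<cdot> \<tau>) \<tau>"
    by (auto simp: comp_subst_def split: option.splits)
  then show ?thesis by (simp add: fill_lit_def subst_lit_comp[symmetric])
qed

text \<open>The contrapositive gives strictness in \<open>lit_gt_subst\<close>: a side containing a
  changed variable really changes.\<close>

lemma subst_trm_eqD: "t \<cdot> \<tau> = t \<cdot> \<tau>' \<Longrightarrow> y \<in> vars_trm t \<Longrightarrow> \<tau> y = \<tau>' y"
  by (induction t) auto


subsection \<open>Sorts\<close>

lemma has_sort_unique: "has_sort \<Sigma> t s \<Longrightarrow> has_sort \<Sigma> t s' \<Longrightarrow> s = s'"
  by (auto elim!: has_sort.cases)

text \<open>Pattern variables live in \<open>'v option\<close>, to which the signature assigns no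
  sorts, so \<open>wf_subst\<close> does not apply to fillings. Sorts of two instances are compared
  directly instead.\<close>

lemma has_sort_subst_cong:
  assumes "\<And>y s. has_sort \<Sigma> (\<tau> y) s \<Longrightarrow> has_sort \<Sigma> (\<tau>' y) s"
  shows "has_sort \<Sigma> (t \<cdot> \<tau>) s \<Longrightarrow> has_sort \<Sigma> (t \<cdot> \<tau>') s"
proof (induction t arbitrary: s)
  case (Var y)
  then show ?case using assms by simp
next
  case (Fun f ts)
  from Fun.prems have "s = res_sort \<Sigma> f"
    and "list_all2 (has_sort \<Sigma>) (map (\<lambda>t. t \<cdot> \<tau>) ts) (arg_sorts \<Sigma> f)"
    by (auto elim: has_sort.cases)
  with Fun.IH show ?case
    by (auto simp: list_all2_conv_all_nth intro!: has_sort.intros)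
qed

lemma wf_lit_iff: "wf_lit \<Sigma> L \<longleftrightarrow> (\<exists>s. \<forall>t\<in>set_literal L. has_sort \<Sigma> t s)"
  by (cases L) (auto simp: wf_eq_def)

lemma wf_lit_subst_cong:
  assumes "\<And>y s. has_sort \<Sigma> (\<tau> y) s \<Longrightarrow> has_sort \<Sigma> (\<tau>' y) s" and "wf_lit \<Sigma> (K \<cdot>l \<tau>)"
  shows "wf_lit \<Sigma> (K \<cdot>l \<tau>')"
  using assms(2) has_sort_subst_cong[of \<Sigma> \<tau> \<tau>', OF assms(1)]
  by (fastforce simp: wf_lit_iff subst_lit_def literal.set_map)

lemma wf_subst_sing: "has_sort \<Sigma> t (var_sort \<Sigma> x) \<Longrightarrow> wf_subst \<Sigma> (sing x t)"
  by (auto simp: wf_subst_def intro: has_sort.intros)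

lemma wf_subst_comp: "wf_subst \<Sigma> \<theta> \<Longrightarrow> wf_subst \<Sigma> \<tau> \<Longrightarrow> wf_subst \<Sigma> (\<theta> \<circ>\<^sub>s \<tau>)"
  unfolding comp_subst_def
  by (subst wf_subst_def) (auto simp: wf_subst_def[of _ \<theta>] intro: has_sort_subst)


subsection \<open>Monotonicity of the ordering\<close>

lemma gt_irrefl:
  assumes "reduction_ordering \<Sigma> gt" and "wf_trm \<Sigma> u"
  shows "\<not> gt u u"
proof -
  have "wfp_on {t. wf_trm \<Sigma> t} (\<lambda>s t. gt t s)"
    using assms(1) by (simp add: reduction_ordering_def)
  then show ?thesis
    using assms(2)
  proof (induction u rule: wfp_on_induct)
    case (less u)
    then show ?case using assms(2) by blast
  qed (simp add: assms(2))
qed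

text \<open>Extends \<open>gt_subst_mono\<close> to simultaneous changes of all variables and to
  terms over unsorted variables. Arguments that decrease weakly are combined by
  \<open>gt_Fun\<close>.\<close>

lemma gt_subst_trm:
  assumes ro: "reduction_ordering \<Sigma> gt"
    and gt: "\<And>y. \<tau> y = \<tau>' y \<or> gt (\<tau> y) (\<tau>' y)"
    and srt: "\<And>y s. has_sort \<Sigma> (\<tau> y) s \<Longrightarrow> has_sort \<Sigma> (\<tau>' y) s"
  shows "has_sort \<Sigma> (t \<cdot> \<tau>) s \<Longrightarrow> t \<cdot> \<tau> = t \<cdot> \<tau>' \<or> gt (t \<cdot> \<tau>) (t \<cdot> \<tau>')"
proof (induction t arbitrary: s)
  case (Var y)
  then show ?case using gt by simp
next
  case (Fun f ts)
  have 1: "list_all2 (has_sort \<Sigma>) (map (\<lambda>t. t \<cdot> \<tau>) ts) (arg_sorts \<Sigma> f)"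
    using Fun.prems by (auto elim: has_sort.cases)
  then have 2: "list_all2 (has_sort \<Sigma>) (map (\<lambda>t. t \<cdot> \<tau>') ts) (arg_sorts \<Sigma> f)"
    using has_sort_subst_cong[of \<Sigma> \<tau> \<tau>', OF srt] by (auto simp: list_all2_conv_all_nth)
  have "t \<cdot> \<tau> = t \<cdot> \<tau>' \<or> gt (t \<cdot> \<tau>) (t \<cdot> \<tau>')" if "t \<in> set ts" for t
  proof -
    from that 1 obtain s where "has_sort \<Sigma> (t \<cdot> \<tau>) s"
      by (auto simp: list_all2_conv_all_nth in_set_conv_nth)
    with that show ?thesis by (rule Fun.IH)
  qed
  then have "list_all2 (\<lambda>u v. u = v \<or> gt u v) (map (\<lambda>t. t \<cdot> \<tau>) ts) (map (\<lambda>t. t \<cdot> \<tau>') ts)"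
    by (auto simp: list_all2_conv_all_nth)
  then show ?case
    using gt_Fun[OF ro, of "[]" "map (\<lambda>t. t \<cdot> \<tau>) ts" f "map (\<lambda>t. t \<cdot> \<tau>') ts"] 1 2 by auto
qed

lemma multp_add_mset_less: "R b a \<Longrightarrow> multp R (add_mset b M) (add_mset a M)"
  using one_step_implies_multp[of "{#a#}" "{#b#}" R M] by simp

text \<open>Elements where \<open>f\<close> and \<open>g\<close> agree form a common part. The
  remaining ones are nonempty in number, and each image under \<open>g\<close> is dominated by the
  image of the same element under \<open>f\<close>, so a single multiset step suffices.\<close>

lemma multp_image_mset:
  assumes "\<And>y. y \<in># M \<Longrightarrow> f y = g y \<or> R (g y) (f y)" and "\<exists>y\<in>#M. f y \<noteq> g y"
  shows "multp R (image_mset g M) (image_mset f M)"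
proof -
  define A B where "A = filter_mset (\<lambda>y. f y = g y) M" and "B = filter_mset (\<lambda>y. f y \<noteq> g y) M"
  have "M = A + B" by (simp add: A_def B_def)
  moreover have "image_mset g A = image_mset f A" by (auto simp: A_def intro: image_mset_cong)
  moreover have "multp R (I + image_mset g B) (I + image_mset f B)" for I
    using assms by (intro one_step_implies_multp) (auto simp: B_def filter_mset_eq_conv)
  ultimately show ?thesis by simp
qed

lemma mset_uprod_Upair: "mset_uprod (Upair a b) = {#a, b#}"
  by (simp add: Upair.abs_eq mset_uprod.abs_eq)

lemma mset_uprod_map: "mset_uprod (map_uprod f e) = image_mset f (mset_uprod e)"
  by (cases e) (simp add: mset_uprod_Upair)

lemma set_mset_uprod: "set_mset (mset_uprod e) = set_uprod e"
  by (cases e) (simp add: mset_uprod_Upair)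

lemma mset_lit_subst: "mset_lit (K \<cdot>l \<tau>) = image_mset (\<lambda>s. s \<cdot> \<tau>) (mset_lit K)"
  by (cases K) (simp_all add: subst_lit_def mset_uprod_map)

lemma set_mset_lit: "set_mset (mset_lit K) = set_literal K"
  by (cases K) (simp_all add: set_mset_uprod)

lemma lit_gt_subst:
  assumes ro: "reduction_ordering \<Sigma> gt" and wf: "wf_lit \<Sigma> (K \<cdot>l \<tau>)"
    and gt: "\<And>y. \<tau> y = \<tau>' y \<or> gt (\<tau> y) (\<tau>' y)"
    and srt: "\<And>y s. has_sort \<Sigma> (\<tau> y) s \<Longrightarrow> has_sort \<Sigma> (\<tau>' y) s"
    and y: "y \<in> vars_lit K" "\<tau> y \<noteq> \<tau>' y"
  shows "lit_gt gt (K \<cdot>l \<tau>) (K \<cdot>l \<tau>')"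
  unfolding lit_gt_def mset_lit_subst
proof (rule multp_image_mset)
  fix u assume "u \<in># mset_lit K"
  then obtain s where s: "has_sort \<Sigma> (u \<cdot> \<tau>) s"
    using wf by (auto simp: set_mset_lit wf_lit_iff subst_lit_def literal.set_map)
  show "u \<cdot> \<tau> = u \<cdot> \<tau>' \<or> gt (u \<cdot> \<tau>) (u \<cdot> \<tau>')"
    by (rule gt_subst_trm[OF ro gt _ s]) (rule srt)
next
  show "\<exists>u\<in>#mset_lit K. u \<cdot> \<tau> \<noteq> u \<cdot> \<tau>'"
    using y by (auto simp: set_mset_lit vars_lit_def dest: subst_trm_eqD)
qed


subsection \<open>Rewriting\<close>

lemma rtranclp_cong_map:
  assumes "\<And>a b. R a b \<Longrightarrow> S (h a) (h b)"
  shows "R\<^sup>*\<^sup>* a b \<Longrightarrow> S\<^sup>*\<^sup>* (h a) (h b)"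
  by (induction rule: rtranclp_induct) (auto dest: assms intro: rtranclp.rtrancl_into_rtrancl)

text \<open>Arguments are rewritten from left to right; \<open>ps\<close> is general so that each
  finished argument can be appended to it.\<close>

lemma rw_trm_Fun:
  "list_all2 (rw_trm \<Sigma> E)\<^sup>*\<^sup>* us vs \<Longrightarrow> (rw_trm \<Sigma> E)\<^sup>*\<^sup>* (Fun f (ps @ us)) (Fun f (ps @ vs))"
proof (induction us vs arbitrary: ps rule: list_all2_induct)
  case (Cons u us v vs)
  have "(rw_trm \<Sigma> E)\<^sup>*\<^sup>* (Fun f (ps @ u # us)) (Fun f (ps @ v # us))"
    by (rule rtranclp_cong_map[OF _ Cons(1), where h = "\<lambda>w. Fun f (ps @ w # us)"])
      (rule rw_trm.intros)
  also have "(rw_trm \<Sigma> E)\<^sup>*\<^sup>* (Fun f (ps @ v # us)) (Fun f (ps @ v # vs))"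
    using Cons.IH[of "ps @ [v]"] by simp
  finally show ?case .
qed simp

lemma rw_trm_subst:
  assumes "\<And>y. (rw_trm \<Sigma> E)\<^sup>*\<^sup>* (\<tau> y) (\<tau>' y)"
  shows "(rw_trm \<Sigma> E)\<^sup>*\<^sup>* (t \<cdot> \<tau>) (t \<cdot> \<tau>')"
proof (induction t)
  case (Fun f ts)
  then have "list_all2 (rw_trm \<Sigma> E)\<^sup>*\<^sup>* (map (\<lambda>t. t \<cdot> \<tau>) ts) (map (\<lambda>t. t \<cdot> \<tau>') ts)"
    by (auto simp: list_all2_conv_all_nth)
  from rw_trm_Fun[OF this, of f "[]"] show ?case by simp
qed (simp add: assms)

lemma rw_lit_subst:
  assumes "\<And>y. (rw_trm \<Sigma> E)\<^sup>*\<^sup>* (\<tau> y) (\<tau>' y)"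
  shows "(rw_lit \<Sigma> E)\<^sup>*\<^sup>* (K \<cdot>l \<tau>) (K \<cdot>l \<tau>')"
proof -
  \<comment> \<open>\<open>H\<close> stands for \<open>Pos\<close> or \<open>Neg\<close>, so both
    signs are treated at once.\<close>
  have *: "(rw_lit \<Sigma> E)\<^sup>*\<^sup>* (H (Upair (a \<cdot> \<tau>) (b \<cdot> \<tau>))) (H (Upair (a \<cdot> \<tau>') (b \<cdot> \<tau>')))"
    if H: "\<And>s t u. rw_trm \<Sigma> E s t \<Longrightarrow> rw_lit \<Sigma> E (H (Upair s u)) (H (Upair t u))" for a b H
  proof -
    have step: "(rw_lit \<Sigma> E)\<^sup>*\<^sup>* (H (Upair (s \<cdot> \<tau>) u)) (H (Upair (s \<cdot> \<tau>') u))" for s u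
      by (rule rtranclp_cong_map[OF _ rw_trm_subst[OF assms], where h = "\<lambda>s. H (Upair s u)"]) (rule H)
    have "(rw_lit \<Sigma> E)\<^sup>*\<^sup>* (H (Upair (a \<cdot> \<tau>) (b \<cdot> \<tau>))) (H (Upair (a \<cdot> \<tau>') (b \<cdot> \<tau>)))"
      by (rule step)
    \<comment> \<open>The hypothesis on \<open>H\<close> rewrites only the component written first.
      As pairs are unordered, a swap exposes the other side, and a second swap restores the
      order.\<close>
    also have "Upair (a \<cdot> \<tau>') (b \<cdot> \<tau>) = Upair (b \<cdot> \<tau>) (a \<cdot> \<tau>')" by simp
    also have "(rw_lit \<Sigma> E)\<^sup>*\<^sup>* (H (Upair (b \<cdot> \<tau>) (a \<cdot> \<tau>'))) (H (Upair (b \<cdot> \<tau>') (a \<cdot> \<tau>')))"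
      by (rule step)
    also have "Upair (b \<cdot> \<tau>') (a \<cdot> \<tau>') = Upair (a \<cdot> \<tau>') (b \<cdot> \<tau>')" by simp
    finally show ?thesis .
  qed
  show ?thesis
  proof (cases K)
    case (Pos e)
    then show ?thesis by (cases e) (simp add: subst_lit_def * rw_lit.intros)
  next
    case (Neg e)
    then show ?thesis by (cases e) (simp add: subst_lit_def * rw_lit.intros)
  qed
qed

text \<open>Well-formedness of \<open>A\<close> forces every atom of \<open>P\<close> to have one
  argument of the sort of \<open>x\<close>, so rewriting is needed only at such \<open>u\<close>.
  Under a quantifier binding \<open>P\<close> both instances coincide and no step is made.\<close>

lemma rw_fm_inst_pred:
  assumes P: "pred_sorts \<Sigma> P = [var_sort \<Sigma> x]"
    and rw: "\<And>u. has_sort \<Sigma> u (var_sort \<Sigma> x) \<Longrightarrow> (rw_lit \<Sigma> E)\<^sup>*\<^sup>* (L \<cdot>l sing x u) (L' \<cdot>l sing x u)"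
  shows "wf_fm \<Sigma> A \<Longrightarrow> (rw_fm \<Sigma> E)\<^sup>*\<^sup>* (inst_pred P x L A) (inst_pred P x L' A)"
proof (induction A)
  case (FPred Q ts)
  have "(rw_fm \<Sigma> E)\<^sup>*\<^sup>* (FClause {#L \<cdot>l sing x u#}) (FClause {#L' \<cdot>l sing x u#})"
    if "has_sort \<Sigma> u (var_sort \<Sigma> x)" for u
    by (rule rtranclp_cong_map[OF _ rw[OF that], where h = "\<lambda>K. FClause {#K#}"]) (rule rw_fm.intros)
  with FPred P show ?case by (auto simp del: fun_upd_apply split: list.splits)
next
  case (FNeg A)
  then show ?case by (auto intro: rtranclp_cong_map[where h = FNeg] rw_fm.intros)
next
  case (FAnd A B)
  then have "(rw_fm \<Sigma> E)\<^sup>*\<^sup>* (FAnd (inst_pred P x L A) (inst_pred P x L B))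
      (FAnd (inst_pred P x L' A) (inst_pred P x L B))"
    by (auto intro: rtranclp_cong_map[where h = "\<lambda>A. FAnd A _"] rw_fm.intros)
  also have "(rw_fm \<Sigma> E)\<^sup>*\<^sup>* \<dots> (FAnd (inst_pred P x L' A) (inst_pred P x L' B))"
    using FAnd by (auto intro: rtranclp_cong_map[where h = "FAnd _"] rw_fm.intros)
  finally show ?case by simp
next
  case (FOr A B)
  then have "(rw_fm \<Sigma> E)\<^sup>*\<^sup>* (FOr (inst_pred P x L A) (inst_pred P x L B))
      (FOr (inst_pred P x L' A) (inst_pred P x L B))"
    by (auto intro: rtranclp_cong_map[where h = "\<lambda>A. FOr A _"] rw_fm.intros)
  also have "(rw_fm \<Sigma> E)\<^sup>*\<^sup>* \<dots> (FOr (inst_pred P x L' A) (inst_pred P x L' B))"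
    using FOr by (auto intro: rtranclp_cong_map[where h = "FOr _"] rw_fm.intros)
  finally show ?case by simp
next
  case (FImp A B)
  then have "(rw_fm \<Sigma> E)\<^sup>*\<^sup>* (FImp (inst_pred P x L A) (inst_pred P x L B))
      (FImp (inst_pred P x L' A) (inst_pred P x L B))"
    by (auto intro: rtranclp_cong_map[where h = "\<lambda>A. FImp A _"] rw_fm.intros)
  also have "(rw_fm \<Sigma> E)\<^sup>*\<^sup>* \<dots> (FImp (inst_pred P x L' A) (inst_pred P x L' B))"
    using FImp by (auto intro: rtranclp_cong_map[where h = "FImp _"] rw_fm.intros)
  finally show ?case by simp
next
  case (FAll y A)
  then show ?case by (auto intro: rtranclp_cong_map[where h = "FAll y"] rw_fm.intros)
next
  case (FEx y A)
  then show ?case by (auto intro: rtranclp_cong_map[where h = "FEx y"] rw_fm.intros)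
next
  case (FAllP Q A)
  then show ?case by (auto intro: rtranclp_cong_map[where h = "FAllP Q"] rw_fm.intros)
next
  case (FExP Q A)
  then show ?case by (auto intro: rtranclp_cong_map[where h = "FExP Q"] rw_fm.intros)
qed simp


subsection \<open>Redundancy\<close>

theorem lemma1:
  fixes \<Sigma> :: "('f, 'v, 'p, 's) signature"
    and gt :: "('f, 'v) trm \<Rightarrow> ('f, 'v) trm \<Rightarrow> bool"
    and cnf :: "('f, 'v, 'p) fm \<Rightarrow> ('f, 'v) clause set"
    and IndT :: "('f, 'v) trm set"
    and \<M> :: "('f, 's, 'd) interp set"
    and P :: 'p and G :: "('f, 'v, 'p) fm"
    and I :: "('f, 'v) inference set"
    and l r t :: "('f, 'v) trm" and L :: "('f, 'v) lit" and C :: "('f, 'v) clause" and x :: 'v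
    and \<theta> \<sigma> :: "('f, 'v, 'v) subst" and K :: "('f, 'v option) lit"
  assumes "reduction_ordering \<Sigma> gt" and "ground_below_ground \<Sigma> gt"
    and "is_cnf TYPE('d) \<Sigma> cnf"
    and "IndT \<subseteq> {u. wf_trm \<Sigma> u}"
    and "valid_induction_schema \<Sigma> \<M> P G"
    and "admits_ED \<Sigma> I"
    and "wf_eq \<Sigma> (Upair l r)"
    and "Ind_applicable \<Sigma> IndT P L x t C"
    and "x \<notin> vars_trm l \<union> vars_trm r"
    and "wf_subst \<Sigma> \<theta>" and "\<sigma> = \<theta> \<circ>\<^sub>s sing x t"
    and "strict_subterm_lit (l \<cdot> \<theta>) L"
    and "hole_lit K" and "fill_lit K (l \<cdot> \<theta>) = L"
    and "gt (l \<cdot> \<sigma>) (r \<cdot> \<sigma>)"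
  shows "redundant_Ind \<Sigma> gt IndT cnf P G (I \<union> Ind_rule \<Sigma> IndT cnf P G) {Upair l r}
           (add_mset (fill_lit (compl_lit (K \<cdot>l lift_subst (sing x t))) (r \<cdot> \<sigma>)) C)
           (Ind_premise L x t C) (Ind_formula P G L x C)"
proof -
  note ro = assms(1) and gbg = assms(2) and wf\<theta> = assms(10) and K = assms(13) and L = assms(14)[symmetric]
  have app: "wf_lit \<Sigma> L" "wf_clause \<Sigma> C" "has_sort \<Sigma> t (var_sort \<Sigma> x)" "pred_sorts \<Sigma> P = [var_sort \<Sigma> x]"
    "x \<notin> vars_trm t \<union> vars_clause C" "vars_lit (L \<cdot>l sing x t) = {}" "t \<in> IndT"
    using assms(8) by (auto simp: Ind_applicable_def)
  define L' where "L' = fill_lit K (r \<cdot> \<theta>)"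
  have \<sigma>: "u \<cdot> \<sigma> = u \<cdot> \<theta> \<cdot> sing x t" for u
    by (simp only: assms(11) subst_trm_comp)
  \<comment> \<open>Both ground literals are instances of \<open>K\<close>; only the term placed at
    \<open>None\<close> differs.\<close>
  have Lt: "L \<cdot>l sing x t = K \<cdot>l case_option (l \<cdot> \<sigma>) (sing x t)"
    by (simp only: L subst_fill_lit \<sigma>)
  have L't: "L' \<cdot>l sing x t = K \<cdot>l case_option (r \<cdot> \<sigma>) (sing x t)"
    by (simp only: L'_def subst_fill_lit \<sigma>)
  obtain s where s: "has_sort \<Sigma> l s" "has_sort \<Sigma> r s"
    using assms(7) by (auto simp: wf_eq_def)
  have wft: "wf_subst \<Sigma> (sing x t)" by (rule wf_subst_sing[OF app(3)])
  have s\<theta>: "has_sort \<Sigma> (l \<cdot> \<theta>) s" "has_sort \<Sigma> (r \<cdot> \<theta>) s"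
    using s has_sort_subst[OF wf\<theta>] by auto
  have s\<sigma>: "has_sort \<Sigma> (l \<cdot> \<sigma>) s" "has_sort \<Sigma> (r \<cdot> \<sigma>) s"
    unfolding \<sigma> using s\<theta> has_sort_subst[OF wft] by auto
  then have wf\<sigma>: "wf_trm \<Sigma> (l \<cdot> \<sigma>)" "wf_trm \<Sigma> (r \<cdot> \<sigma>)" by (auto simp: wf_trm_def)

  have None: "None \<in> vars_lit K" using K by (simp add: hole_lit_def)
  \<comment> \<open>Since \<open>None\<close> occurs in \<open>K\<close>, the term
    \<open>l \<cdot> \<sigma>\<close> lies inside the ground literal \<open>L[t]\<close>.\<close>
  have "vars_trm (l \<cdot> \<sigma>) = {}"
    using app(6) None unfolding Lt vars_subst_lit by force
  then have gr: "vars_trm (r \<cdot> \<sigma>) = {}"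
    using gbg wf\<sigma> assms(15) unfolding ground_below_ground_def by blast
  have vars: "vars_lit (L' \<cdot>l sing x t) = {}"
    using app(6) gr unfolding Lt L't vars_subst_lit
    by (auto simp del: fun_upd_apply split: option.splits)
  \<comment> \<open>By uniqueness of sorts, any sort of \<open>l \<cdot> \<theta>\<close> is the
    common sort \<open>s\<close>, which \<open>r \<cdot> \<theta>\<close> has too.\<close>
  have wfL': "wf_lit \<Sigma> L'"
    using app(1) unfolding L L'_def fill_lit_def
    by (rule wf_lit_subst_cong[rotated])
      (auto split: option.splits dest: has_sort_unique[OF s\<theta>(1)] simp: s\<theta>(2))
  have app': "Ind_applicable \<Sigma> IndT P L' x t C"
    unfolding Ind_applicable_def using app wfL' vars by blast

  have prem: "add_mset (fill_lit (compl_lit (K \<cdot>l lift_subst (sing x t))) (r \<cdot> \<sigma>)) C = Ind_premise L' x t C"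
    unfolding Ind_premise_def L't
    by (simp only: compl_subst_lit[symmetric] fill_lift_subst)

  have wfLt: "wf_lit \<Sigma> (compl_lit (L \<cdot>l sing x t))"
    using app(1) has_sort_subst[OF wft]
    by (cases L) (fastforce simp: wf_eq_def subst_lit_def uprod.set_map simp del: fun_upd_apply)+
  \<comment> \<open>Complement commutes with substitution, so \<open>compl_lit K\<close> serves as
    the pattern, and \<open>None\<close> is the variable witnessing strict decrease.\<close>
  have "lit_gt gt (compl_lit (L \<cdot>l sing x t)) (compl_lit (L' \<cdot>l sing x t))"
    unfolding Lt L't compl_subst_lit[symmetric]
  proof (rule lit_gt_subst[OF ro])
    show "wf_lit \<Sigma> (compl_lit K \<cdot>l case_option (l \<cdot> \<sigma>) (sing x t))"
      using wfLt by (simp only: Lt compl_subst_lit)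
    show "None \<in> vars_lit (compl_lit K)" using None by (simp add: vars_compl_lit)
    show "case_option (l \<cdot> \<sigma>) (sing x t) None \<noteq> case_option (r \<cdot> \<sigma>) (sing x t) None"
      using assms(15) gt_irrefl[OF ro wf\<sigma>(1)] by auto
  qed (auto split: option.splits simp: assms(15) s\<sigma>(2) simp del: fun_upd_apply
      dest: has_sort_unique[OF s\<sigma>(1)])
  then have gt: "clause_gt gt (Ind_premise L x t C) (Ind_premise L' x t C)"
    unfolding clause_gt_def Ind_premise_def by (rule multp_add_mset_less)

  have "(rw_lit \<Sigma> {Upair l r})\<^sup>*\<^sup>* (L \<cdot>l sing x u) (L' \<cdot>l sing x u)"
    if "has_sort \<Sigma> u (var_sort \<Sigma> x)" for u
    unfolding L L'_def subst_fill_lit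
  proof (rule rw_lit_subst)
    fix y
    \<comment> \<open>At \<open>None\<close> a single root step with matcher
      \<open>\<theta> \<circ>\<^sub>s sing x u\<close> is enough; at every other variable the two
      substitutions agree.\<close>
    have "rw_trm \<Sigma> {Upair l r} (l \<cdot> (\<theta> \<circ>\<^sub>s sing x u)) (r \<cdot> (\<theta> \<circ>\<^sub>s sing x u))"
      by (rule rw_trm.intros) (simp_all add: wf_subst_comp[OF wf\<theta> wf_subst_sing[OF that]] del: fun_upd_apply)
    then show "(rw_trm \<Sigma> {Upair l r})\<^sup>*\<^sup>* (case_option (l \<cdot> \<theta> \<cdot> sing x u) (sing x u) y)
        (case_option (r \<cdot> \<theta> \<cdot> sing x u) (sing x u) y)"
      by (auto simp: subst_trm_comp simp del: fun_upd_apply split: option.splits)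
  qed
  then have "(rw_fm \<Sigma> {Upair l r})\<^sup>*\<^sup>* (inst_pred P x L G) (inst_pred P x L' G)"
    using assms(5) by (intro rw_fm_inst_pred[OF app(4)]) (auto simp: valid_induction_schema_def)
  then have "(rw_fm \<Sigma> {Upair l r})\<^sup>*\<^sup>* (Ind_formula P G L x C) (Ind_formula P G L' x C)"
    unfolding Ind_formula_def
    by (rule rtranclp_cong_map[rotated, where h = "\<lambda>A. FOr (FNeg A) (FClause C)"]) (intro rw_fm.intros)
  then have eq: "equiv_modulo \<Sigma> {Upair l r} (Ind_formula P G L x C) (Ind_formula P G L' x C)"
    unfolding equiv_modulo_def by (rule rtranclp_into_equivclp)

  have "Ind_inference \<Sigma> IndT P G (Ind_premise L x t C) (Ind_formula P G L x C)"
    "Ind_inference \<Sigma> IndT P G (Ind_premise L' x t C) (Ind_formula P G L' x C)"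
    using assms(8) app' unfolding Ind_inference_def by blast+
  then show ?thesis
    unfolding prem redundant_Ind_def Ind_rule_def using gt eq by blast
qed

end
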